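(* Let $P$ be a Schröder path and let $(x,z)\in\mathbb{Z}^2$ be a point on $P$ with $z>x+1$ such that the bounce path of $P$ at $(x,z)$ has exactly one bounce point and the bounce decomposition of $P$ at $(x,z)$ is $P=U\mathtt{d}\cdot\mathtt{n}V\mathtt{d}\cdot\mathtt{e}W$. Let $Q=U\mathtt{n}\mathtt{d}V\mathtt{e}\mathtt{d}W$. Then $\mathrm{LLTe}_P(\mathbf{x};q+1)=\mathrm{LLTe}_Q(\mathbf{x};q+1)$.
   Context: Steps: $\mathtt{n}=(0,1)$, $\mathtt{e}=(1,0)$, $\mathtt{d}=(1,1)$. A Schröder path of size $n$ is a lattice path from $(0,0)$ to $(n,n)$ with steps in $\{\mathtt{n},\mathtt{e},\mathtt{d}\}$ such that every east and every diagonal step is preceded by strictly more north steps than east steps; paths are words in $\{\mathtt{n},\mathtt{d},\mathtt{e}\}^*$. Bounce path of $P$ (size $n$) at a lattice point $(u_1,u_0)$ on $P$: move south from $(u_1,u_0)$ to $(u_1,u_1)$, then west until first reaching a point $(u_2,u_1)$ of $P$; if that point lies between two diagonal steps of $P$, continue south to $(u_2,u_2)$ and west to a point $(u_3,u_2)$ of $P$, and so on, stopping at the first point $(u_{k+1},u_k)$ incident to a north or east step of $P$. The points $(u_i,u_i)$ are the bounce points. The bounce decomposition at $(u_1,u_0)$ is the unique factorisation $P=Us_1\cdot s_2Vs_3\cdot s_4W$ ($s_i$ single steps) where $Us_1$ is the part of $P$ from $(0,0)$ to $(u_{k+1},u_k)$ and $s_4W$ is the part from $(u_1,u_0)$ to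 $(n,n)$; dots are only markers. $\Gamma_P$ is the graph on $[n]$ where, for $1\le a<b\le n$, $\{a,b\}$ is a non-strict edge if the unit square $[a-1,a]\times[b-1,b]$ lies in the region between $P$ and the line $y=x$, and a strict edge if $P$ has a diagonal step from $(a-1,b-1)$ to $(a,b)$. An orientation is a set $\theta$ containing, for each edge $\{u,v\}$, exactly one of $u\to v$, $v\to u$; $\mathcal{O}(P)$ is the set of orientations orienting each strict edge $\{u,v\}$, $u<v$, as $u\to v$. An edge $u\to v\in\theta$ is ascending if $u<v$ and $\{u,v\}$ is non-strict; $\mathrm{asc}(\theta)$ counts them. $\mathrm{hrv}_\theta(u)$ is the maximal $v$ reachable from $u$ by a directed path (possibly empty) in $\theta$ using only strict and ascending edges; $\lambda(\theta)$ is the partition formed by the sizes of the classes of vertices with equal $\mathrm{hrv}_\theta$. $\mathrm{LLTe}_P(\mathbf{x};q+1)=\sum_{\theta\in\mathcal{O}(P)}q^{\mathrm{asc}(\theta)}\mathrm{e}_{\lambda(\theta)}(\mathbf{x})$, with $\mathrm{e}_\lambda$ the elementary symmetric functions. *)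

theory Defs
  imports "HOL-Analysis.Analysis" "HOL-Library.Multiset" "HOL-Computational_Algebra.Polynomial"
begin

text \<open>
  The monomial \<open>x\<^sub>i x\<^sub>j \<cdots>\<close> is encoded as the multiset \<open>{#i, j, \<dots>#}\<close>, and a power series as its
  coefficient function. The ring of symmetric functions over \<open>'a\<close> is the subring of symmetric
  series of bounded degree.
\<close>

typedef 'a mps = "UNIV :: (nat multiset \<Rightarrow> 'a) set"
  morphisms mps_coeff Abs_mps ..

setup_lifting type_definition_mps

lemma mps_eqI: "(\<And>M. mps_coeff f M = mps_coeff g M) \<Longrightarrow> f = g"
  by transfer auto

lemma finite_submultisets: "finite {A. A \<subseteq># (M :: 'b multiset)}"
proof (induction M)
  case (add x M)
  let ?S = "{A. A \<subseteq># M}"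
  have "{A. A \<subseteq># add_mset x M} \<subseteq> ?S \<union> add_mset x ` ?S"
  proof
    fix A assume A: "A \<in> {A. A \<subseteq># add_mset x M}"
    show "A \<in> ?S \<union> add_mset x ` ?S"
    proof (cases "x \<in># A")
      case True
      then obtain B where "A = add_mset x B"
        by (blast dest: multi_member_split)
      with A show ?thesis by auto
    next
      case False
      have "count A y \<le> count M y" for y
      proof (cases "y = x")
        case True
        with False show ?thesis by (simp add: not_in_iff)
      next
        case False
        from A have "count A y \<le> count (add_mset x M) y"
          by (simp only: mem_Collect_eq subseteq_mset_def)
        with False show ?thesis by simp
      qed
      then show ?thesis by (simp add: subseteq_mset_def)
    qed
  qed
  with add show ?case
    by (meson finite_UnI finite_imageI finite_subset)
qed auto

instantiation mps :: (comm_ring_1) comm_ring_1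
begin

lift_definition zero_mps :: "'a mps" is "\<lambda>_. 0" .
lift_definition one_mps :: "'a mps" is "\<lambda>M. if M = {#} then 1 else 0" .
lift_definition plus_mps :: "'a mps \<Rightarrow> 'a mps \<Rightarrow> 'a mps" is "\<lambda>f g M. f M + g M" .
lift_definition minus_mps :: "'a mps \<Rightarrow> 'a mps \<Rightarrow> 'a mps" is "\<lambda>f g M. f M - g M" .
lift_definition uminus_mps :: "'a mps \<Rightarrow> 'a mps" is "\<lambda>f M. - f M" .
lift_definition times_mps :: "'a mps \<Rightarrow> 'a mps \<Rightarrow> 'a mps" is
  "\<lambda>f g M. \<Sum>A | A \<subseteq># M. f A * g (M - A)" .

instance
proof
  fix f g h :: "'a mps"
  show "f * g * h = f * (g * h)"
  proof (transfer, rule ext)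
    fix f g h :: "nat multiset \<Rightarrow> 'a" and M
    have "(\<Sum>A | A \<subseteq># M. (\<Sum>B | B \<subseteq># A. f B * g (A - B)) * h (M - A)) =
        (\<Sum>(A, B) \<in> Sigma {A. A \<subseteq># M} (\<lambda>A. {B. B \<subseteq># A}). f B * g (A - B) * h (M - A))"
      by (subst sum.Sigma[symmetric]) (auto simp: finite_submultisets sum_distrib_right)
    also have "\<dots> =
        (\<Sum>(A, B) \<in> Sigma {A. A \<subseteq># M} (\<lambda>A. {B. B \<subseteq># M - A}). f A * (g B * h (M - A - B)))"
    proof (rule sum.reindex_bij_witness
        [where i = "\<lambda>(A, B). (A + B, A)" and j = "\<lambda>(A, B). (B, A - B)"], goal_cases)
      case (1 a)
      then show ?case by (auto simp: subset_mset.add_diff_inverse)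
    next
      case (2 a)
      then show ?case
        by (auto simp: subseteq_mset_def diff_le_mono intro: le_trans)
    next
      case (3 b)
      then show ?case by auto
    next
      case (4 b)
      then show ?case
        by (auto simp: subset_mset.le_diff_conv2 add.commute)
    next
      case (5 a)
      then obtain A B where "a = (A, B)" "B \<subseteq># A" by auto
      then have "M - B - (A - B) = M - A"
        by (simp add: diff_diff_add_mset subset_mset.add_diff_inverse)
      with \<open>a = (A, B)\<close> show ?case by (simp add: mult.assoc)
    qed
    also have "\<dots> = (\<Sum>A | A \<subseteq># M. f A * (\<Sum>B | B \<subseteq># M - A. g B * h (M - A - B)))"
      by (subst sum.Sigma[symmetric]) (auto simp: finite_submultisets sum_distrib_left)
    finally show "(\<Sum>A | A \<subseteq># M. (\<Sum>B | B \<subseteq># A. f B * g (A - B)) * h (M - A)) =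
        (\<Sum>A | A \<subseteq># M. f A * (\<Sum>B | B \<subseteq># M - A. g B * h (M - A - B)))" .
  qed
  show "f * g = g * f"
  proof (transfer, rule ext)
    fix f g :: "nat multiset \<Rightarrow> 'a" and M
    show "(\<Sum>A | A \<subseteq># M. f A * g (M - A)) = (\<Sum>A | A \<subseteq># M. g A * f (M - A))"
    proof -
      have "M - (M - A) = A" if "A \<subseteq># M" for A
        using that by (simp add: multiset_eq_iff subseteq_mset_def)
      then show ?thesis
        by (intro sum.reindex_bij_witness[where i = "\<lambda>A. M - A" and j = "\<lambda>A. M - A"])
          (auto simp: mult.commute)
    qed
  qed
  show "1 * f = f"
  proof (transfer, rule ext)
    fix f :: "nat multiset \<Rightarrow> 'a" and M
    have "(\<Sum>A | A \<subseteq># M. (if A = {#} then 1 else 0) * f (M - A)) =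
        (\<Sum>A | A \<subseteq># M. if A = {#} then f M else 0)"
      by (rule sum.cong) auto
    then show "(\<Sum>A | A \<subseteq># M. (if A = {#} then 1 else 0) * f (M - A)) = f M"
      by (simp add: sum.delta finite_submultisets)
  qed
  show "(f + g) * h = f * h + g * h"
    by transfer (simp add: distrib_right sum.distrib)
  show "f + g + h = f + (g + h)"
    by transfer (simp add: add.assoc)
  show "f + g = g + f"
    by transfer (simp add: add.commute)
  show "0 + f = f"
    by transfer simp
  show "- f + f = 0"
    by transfer simp
  show "f - g = f + - g"
    by transfer simp
  show "(0 :: 'a mps) \<noteq> 1"
    by transfer (auto simp: fun_eq_iff)
qed

end

lift_definition mps_const :: "'a \<Rightarrow> 'a :: zero mps" is "\<lambda>c M. if M = {#} then c else 0" .

text \<open>A multiset has no repeated elements iff it equals \<open>mset_set\<close> of its underlying set.\<close>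

lift_definition elem_sym :: "nat \<Rightarrow> 'a :: zero_neq_one mps" is
  "\<lambda>k M. if size M = k \<and> M = mset_set (set_mset M) then 1 else 0" .

definition elem_sym_partition :: "nat multiset \<Rightarrow> 'a :: comm_ring_1 mps" where
  "elem_sym_partition \<mu> = (\<Prod>k\<in>#\<mu>. elem_sym k)"

datatype step = North | East | Diag

definition endpoint :: "step list \<Rightarrow> nat \<times> nat" where
  "endpoint w = (count_list w East + count_list w Diag, count_list w North + count_list w Diag)"

definition lattice_points :: "step list \<Rightarrow> (nat \<times> nat) set" where
  "lattice_points P = {endpoint (take i P) | i. i \<le> length P}"

definition schroeder_path :: "nat \<Rightarrow> step list \<Rightarrow> bool" where
  "schroeder_path n P \<longleftrightarrow> endpoint P = (n, n) \<and>
    (\<forall>i < length P. P ! i \<in> {East, Diag} \<longrightarrow>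
      count_list (take i P) North > count_list (take i P) East)"

definition path_size :: "step list \<Rightarrow> nat" where
  "path_size P = fst (endpoint P)"

lemma path_size_schroeder_path: "schroeder_path n P \<Longrightarrow> path_size P = n"
  by (simp add: schroeder_path_def path_size_def)

text \<open>\<open>west_hit P u\<close> is the abscissa of the first point of \<open>P\<close> reached when going west from
  \<open>(u, u)\<close>, where \<open>(u, u)\<close> itself counts if it lies on \<open>P\<close>.\<close>

definition west_hit :: "step list \<Rightarrow> nat \<Rightarrow> nat" where
  "west_hit P u = Max {v. v \<le> u \<and> (v, u) \<in> lattice_points P}"

text \<open>The sequence \<open>u\<^sub>0, u\<^sub>1, u\<^sub>2, \<dots>\<close> of the bounce path at \<open>(u\<^sub>1, u\<^sub>0)\<close>, continued without
  regard to the stopping condition.\<close>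

fun bounce_seq :: "step list \<Rightarrow> nat \<times> nat \<Rightarrow> nat \<Rightarrow> nat" where
  "bounce_seq P p 0 = snd p"
| "bounce_seq P p (Suc 0) = fst p"
| "bounce_seq P p (Suc (Suc i)) = west_hit P (bounce_seq P p (Suc i))"

definition incident_north_or_east :: "step list \<Rightarrow> nat \<times> nat \<Rightarrow> bool" where
  "incident_north_or_east P p \<longleftrightarrow>
    (\<exists>i < length P. P ! i \<in> {North, East} \<and>
      (p = endpoint (take i P) \<or> p = endpoint (take (Suc i) P)))"

text \<open>The index \<open>k\<close> such that the bounce path stops at \<open>(u\<^bsub>k+1\<^esub>, u\<^sub>k)\<close>. Such an index exists for
  a Schroeder path of positive size: the \<open>u\<^sub>i\<close> decrease until they are stationary, and a
  point of the path on the main diagonal is never incident to a diagonal step.\<close>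

definition bounce_length :: "step list \<Rightarrow> nat \<times> nat \<Rightarrow> nat" where
  "bounce_length P p =
    (LEAST k. 1 \<le> k \<and> incident_north_or_east P (bounce_seq P p (Suc k), bounce_seq P p k))"

definition bounce_points :: "step list \<Rightarrow> nat \<times> nat \<Rightarrow> (nat \<times> nat) set" where
  "bounce_points P p = {(bounce_seq P p i, bounce_seq P p i) | i. 1 \<le> i \<and> i \<le> bounce_length P p}"

definition bounce_decomposition ::
    "step list \<Rightarrow> nat \<times> nat \<Rightarrow> step list \<Rightarrow> step \<Rightarrow> step \<Rightarrow> step list \<Rightarrow> step \<Rightarrow> step \<Rightarrow> step list \<Rightarrow> bool"
  where
  "bounce_decomposition P p U s1 s2 V s3 s4 W \<longleftrightarrow>
    P = (U @ [s1]) @ (s2 # V @ [s3]) @ (s4 # W) \<and>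
    endpoint (U @ [s1]) =
      (bounce_seq P p (Suc (bounce_length P p)), bounce_seq P p (bounce_length P p)) \<and>
    endpoint ((U @ [s1]) @ (s2 # V @ [s3])) = p"

definition real_point :: "nat \<times> nat \<Rightarrow> real \<times> real" where
  "real_point p = (real (fst p), real (snd p))"

definition path_curve :: "step list \<Rightarrow> (real \<times> real) set" where
  "path_curve P = (\<Union>i < length P.
    closed_segment (real_point (endpoint (take i P))) (real_point (endpoint (take (Suc i) P))))"

text \<open>The region is closed, so unit squares contained in it may touch \<open>P\<close> and the diagonal, but
  the squares cut in half by a diagonal step are not contained in it.\<close>

definition path_region :: "step list \<Rightarrow> (real \<times> real) set" where
  "path_region P = {(s, t). s \<le> t \<and> (\<exists>t'. t \<le> t' \<and> (s, t') \<in> path_curve P)}"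

definition nonstrict_edges :: "step list \<Rightarrow> nat set set" where
  "nonstrict_edges P = {{a, b} | a b. 1 \<le> a \<and> a < b \<and> b \<le> path_size P \<and>
    {real a - 1..real a} \<times> {real b - 1..real b} \<subseteq> path_region P}"

definition strict_edges :: "step list \<Rightarrow> nat set set" where
  "strict_edges P = {{a, b} | a b. 1 \<le> a \<and> a < b \<and> b \<le> path_size P \<and>
    (\<exists>i < length P. P ! i = Diag \<and>
      endpoint (take i P) = (a - 1, b - 1) \<and> endpoint (take (Suc i) P) = (a, b))}"

definition graph_edges :: "step list \<Rightarrow> nat set set" where
  "graph_edges P = nonstrict_edges P \<union> strict_edges P"

text \<open>The directed edge from \<open>u\<close> to \<open>v\<close> is the pair \<open>(u, v)\<close>.\<close>

definition orientations :: "step list \<Rightarrow> (nat \<times> nat) set set" where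
  "orientations P = {\<theta>.
    (\<forall>(u, v) \<in> \<theta>. {u, v} \<in> graph_edges P) \<and>
    (\<forall>u v. {u, v} \<in> graph_edges P \<longrightarrow> ((u, v) \<in> \<theta>) \<noteq> ((v, u) \<in> \<theta>)) \<and>
    (\<forall>u v. u < v \<and> {u, v} \<in> strict_edges P \<longrightarrow> (u, v) \<in> \<theta>)}"

definition ascending_edges :: "step list \<Rightarrow> (nat \<times> nat) set \<Rightarrow> (nat \<times> nat) set" where
  "ascending_edges P \<theta> = {(u, v) \<in> \<theta>. u < v \<and> {u, v} \<in> nonstrict_edges P}"

definition asc :: "step list \<Rightarrow> (nat \<times> nat) set \<Rightarrow> nat" where
  "asc P \<theta> = card (ascending_edges P \<theta>)"

definition hrv :: "step list \<Rightarrow> (nat \<times> nat) set \<Rightarrow> nat \<Rightarrow> nat" where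
  "hrv P \<theta> u =
    Max {v. (u, v) \<in> ({(a, b) \<in> \<theta>. {a, b} \<in> strict_edges P} \<union> ascending_edges P \<theta>)\<^sup>*}"

definition hrv_partition :: "step list \<Rightarrow> (nat \<times> nat) set \<Rightarrow> nat multiset" where
  "hrv_partition P \<theta> =
    {# card {u \<in> {1..path_size P}. hrv P \<theta> u = v}. v \<in># mset_set (hrv P \<theta> ` {1..path_size P}) #}"

text \<open>\<open>LLTe P t\<close> is \<open>LLTe\<^sub>P(x; t)\<close>. The defining formula is for \<open>t = q + 1\<close>, whence the
  powers of \<open>t - 1\<close>.\<close>

definition LLTe :: "step list \<Rightarrow> 'a :: comm_ring_1 \<Rightarrow> 'a mps" where
  "LLTe P t =
    (\<Sum>\<theta> \<in> orientations P. mps_const ((t - 1) ^ asc P \<theta>) * elem_sym_partition (hrv_partition P \<theta>))"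

lemma LLTe_shifted:
  "LLTe P (q + 1) =
    (\<Sum>\<theta> \<in> orientations P. mps_const (q ^ asc P \<theta>) * elem_sym_partition (hrv_partition P \<theta>))"
  by (simp add: LLTe_def)

end

theory Submission
  imports Defs
begin

text \<open>
  Let \<open>(y, x)\<close> be the point where the bounce path stops. The vertices \<open>x\<close> and \<open>x + 1\<close> are then
  twins up to their edges to \<open>y\<close> and \<open>z\<close>: with common arc sets invariant under exchanging \<open>x\<close> and
  \<open>x + 1\<close>, the graph of \<open>P\<close> has the strict arcs \<open>y \<rightarrow> x \<rightarrow> z\<close> and the non-strict arcs
  \<open>x \<rightarrow> x + 1\<close>, \<open>x + 1 \<rightarrow> z\<close>, while the graph of \<open>Q\<close> has the strict arcs \<open>y \<rightarrow> x + 1 \<rightarrow> z\<close> and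
  the non-strict arcs \<open>x \<rightarrow> x + 1\<close>, \<open>y \<rightarrow> x\<close>. An orientation is determined by its set of ascending
  arcs. Fix the common ascending arcs and compare the highest vertices \<open>\<alpha>\<close>, \<open>\<beta>\<close> reachable from
  \<open>x\<close>, \<open>x + 1\<close> once both are joined to \<open>z\<close>. Depending on whether \<open>\<alpha> < \<beta>\<close>, each choice of the two
  special ascending arcs of \<open>P\<close> is matched with a choice of as many special arcs of \<open>Q\<close>, exchanging
  \<open>x\<close> and \<open>x + 1\<close> in the common arcs in some of the cases. The two arc sets then differ, up to
  that exchange, only in arcs that do not change any highest reachable vertex.
\<close>

section \<open>Highest reachable vertices\<close>

text \<open>All arcs used by \<open>hrv\<close> increase; finiteness makes the maximum in
  \<open>highest\<close> exist.\<close>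

definition upward :: "(nat \<times> nat) set \<Rightarrow> bool" where
  "upward R \<longleftrightarrow> finite R \<and> (\<forall>(u, v) \<in> R. u < v)"

lemma upward_insert [simp]: "upward (insert (u, v) R) \<longleftrightarrow> u < v \<and> upward R"
  by (auto simp: upward_def)

lemma upward_Un [simp]: "upward (R \<union> S) \<longleftrightarrow> upward R \<and> upward S"
  by (auto simp: upward_def)

lemma upward_subset: "upward R \<Longrightarrow> S \<subseteq> R \<Longrightarrow> upward S"
  by (auto simp: upward_def intro: finite_subset)

lemma upward_rtrancl_le:
  assumes "upward R" "(u, v) \<in> R\<^sup>*"
  shows "u \<le> v"
  using assms(2,1) by induction (auto simp: upward_def intro: less_imp_le order.strict_trans1)

text \<open>No vertex lies strictly between \<open>u\<close> and \<open>Suc u\<close>. Hence,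
  without the arc \<open>(x, Suc x)\<close>, the twin \<open>Suc x\<close> is unreachable from
  \<open>x\<close>.\<close>

lemma upward_rtrancl_Suc:
  assumes "upward R" "(u, Suc u) \<in> R\<^sup>*"
  shows "(u, Suc u) \<in> R"
  using assms(2)
proof (cases rule: converse_rtranclE)
  case (step v)
  moreover have "u < v" "v \<le> Suc u"
    using assms(1) step upward_rtrancl_le[OF assms(1)] by (auto simp: upward_def)
  ultimately have "v = Suc u" by linarith
  with step show ?thesis by simp
qed simp

definition highest :: "(nat \<times> nat) set \<Rightarrow> nat \<Rightarrow> nat" where
  "highest R u = Max {v. (u, v) \<in> R\<^sup>*}"

lemma finite_reachable: "finite R \<Longrightarrow> finite {v. (u, v) \<in> R\<^sup>*}"
  by (rule finite_subset[of _ "insert u (Range R)"])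
    (auto elim: rtranclE simp: finite_Range)

lemma highest_reachable:
  assumes "upward R"
  shows "(u, highest R u) \<in> R\<^sup>*"
proof -
  have "highest R u \<in> {v. (u, v) \<in> R\<^sup>*}"
    unfolding highest_def using assms
    by (intro Max_in finite_reachable) (auto simp: upward_def)
  then show ?thesis by simp
qed

lemma highest_ge: "upward R \<Longrightarrow> (u, v) \<in> R\<^sup>* \<Longrightarrow> v \<le> highest R u"
  unfolding highest_def by (intro Max_ge finite_reachable) (auto simp: upward_def)

lemma highest_ge_self: "upward R \<Longrightarrow> u \<le> highest R u"
  by (simp add: highest_ge)

lemma highest_mono: "upward R \<Longrightarrow> (u, v) \<in> R\<^sup>* \<Longrightarrow> highest R v \<le> highest R u"
  by (meson highest_ge highest_reachable rtrancl_trans)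

text \<open>A walk through the new arc can be cut before its first and after its last use of that
  arc, so exactly the vertices reaching \<open>u\<close> gain what \<open>v\<close> reaches.\<close>

lemma highest_insert:
  assumes "upward R"
  shows "highest (insert (u, v) R) w =
    (if (w, u) \<in> R\<^sup>* then max (highest R w) (highest R v) else highest R w)"
proof -
  have "{v'. (w, v') \<in> (insert (u, v) R)\<^sup>*} = {v'. (w, v') \<in> R\<^sup>*} \<union>
      (if (w, u) \<in> R\<^sup>* then {v'. (v, v') \<in> R\<^sup>*} else {})"
    by (auto simp: rtrancl_insert)
  moreover have "finite {v'. (a, v') \<in> R\<^sup>*}" "{v'. (a, v') \<in> R\<^sup>*} \<noteq> {}" for a
    using assms by (auto simp: upward_def finite_reachable)
  ultimately show ?thesis
    by (simp add: highest_def Max_Un)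
qed

text \<open>Whatever reaches \<open>u\<close> already has a highest vertex at least that of
  \<open>u\<close>. This is the criterion by which the exchange argument adds and drops
  arcs.\<close>

lemma highest_insert_redundant:
  assumes "upward R" "highest R v \<le> highest R u"
  shows "highest (insert (u, v) R) = highest R"
  using assms by (auto simp: fun_eq_iff highest_insert max_def dest: highest_mono)

lemma highest_insert_above:
  "upward R \<Longrightarrow> u < w \<Longrightarrow> highest (insert (u, v) R) w = highest R w"
  by (auto simp: highest_insert dest: upward_rtrancl_le)

lemma highest_insert_Suc:
  "upward R \<Longrightarrow> (w, Suc w) \<notin> R \<Longrightarrow> highest (insert (Suc w, v) R) w = highest R w"
  by (auto simp: highest_insert dest: upward_rtrancl_Suc)

lemma highest_insert_source:
  "upward R \<Longrightarrow> highest (insert (u, v) R) u = max (highest R u) (highest R v)"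
  by (simp add: highest_insert)

lemmas highest_insert_simps =
  highest_insert_above highest_insert_Suc highest_insert_source

section \<open>Exchange of two adjacent vertices\<close>

abbreviation adj_transp :: "nat \<Rightarrow> nat \<Rightarrow> nat" where
  "adj_transp x \<equiv> Transposition.transpose x (Suc x)"

definition swap_adj :: "nat \<Rightarrow> (nat \<times> nat) set \<Rightarrow> (nat \<times> nat) set" where
  "swap_adj x = (`) (map_prod (adj_transp x) (adj_transp x))"

lemma swap_adj_iff:
  "(u, v) \<in> swap_adj x R \<longleftrightarrow> (adj_transp x u, adj_transp x v) \<in> R"
  unfolding swap_adj_def by (force simp: image_iff)

lemma swap_adj_involutory [simp]: "swap_adj x (swap_adj x R) = R"
  by (auto simp: swap_adj_iff)

lemma swap_adj_insert:
  "swap_adj x (insert (u, v) R) =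
    insert (adj_transp x u, adj_transp x v) (swap_adj x R)"
  by (simp add: swap_adj_def)

lemma swap_adj_Un: "swap_adj x (R \<union> S) = swap_adj x R \<union> swap_adj x S"
  by (simp add: swap_adj_def image_Un)

lemma card_swap_adj [simp]: "card (swap_adj x R) = card R"
  unfolding swap_adj_def
  by (rule card_image) (auto intro!: inj_onI simp: transpose_eq_iff)

lemma swap_adj_Pow:
  assumes "swap_adj x C = C" "R \<in> Pow C"
  shows "swap_adj x R \<in> Pow C"
  using assms by (metis PowD PowI Un_absorb2 swap_adj_Un sup.absorb_iff1)

text \<open>The transposition reverses the order of the pair \<open>x\<close>, \<open>Suc x\<close>
  only.\<close>

lemma upward_swap_adj:
  assumes "upward R" "(x, Suc x) \<notin> R"
  shows "upward (swap_adj x R)"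
proof -
  have "u < v" if "(u, v) \<in> swap_adj x R" for u v
  proof -
    have "adj_transp x u < adj_transp x v"
      using that assms(1) by (auto simp: swap_adj_iff upward_def)
    moreover have "\<not> (u = Suc x \<and> v = x)"
      using that assms(2) by (auto simp: swap_adj_iff)
    ultimately show ?thesis
      by (auto simp: Transposition.transpose_def split: if_splits)
  qed
  moreover have "finite (swap_adj x R)"
    using assms(1) by (simp add: upward_def swap_adj_def)
  ultimately show ?thesis
    by (auto simp: upward_def)
qed

lemma swap_adj_rtrancl:
  assumes "(u, v) \<in> R\<^sup>*"
  shows "(adj_transp x u, adj_transp x v) \<in> (swap_adj x R)\<^sup>*"
  using assms
proof induction
  case (step v w)
  then have "(adj_transp x v, adj_transp x w) \<in> swap_adj x R"
    by (simp add: swap_adj_iff)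
  with step show ?case by (meson rtrancl.rtrancl_into_rtrancl)
qed simp

lemma swap_adj_rtrancl_iff:
  "(adj_transp x u, v) \<in> (swap_adj x R)\<^sup>* \<longleftrightarrow> (u, adj_transp x v) \<in> R\<^sup>*"
  using swap_adj_rtrancl[of u "adj_transp x v" R x]
    swap_adj_rtrancl[of "adj_transp x u" v "swap_adj x R" x] by auto

text \<open>The hypothesis on \<open>x\<close> excludes that \<open>Suc x\<close> is the highest vertex reachable from a vertex
  that also reaches \<open>x\<close>, the one situation in which the maximum is not equivariant.\<close>

lemma highest_swap_adj:
  assumes "upward R" "(x, Suc x) \<notin> R" "highest R x > Suc x"
  shows "highest (swap_adj x R) (adj_transp x u) = adj_transp x (highest R u)"
proof (rule antisym)
  let ?s = "adj_transp x"
  have up: "upward (swap_adj x R)"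
    by (rule upward_swap_adj[OF assms(1,2)])
  have "(?s u, ?s (highest R u)) \<in> (swap_adj x R)\<^sup>*"
    by (rule swap_adj_rtrancl) (rule highest_reachable[OF assms(1)])
  then show "?s (highest R u) \<le> highest (swap_adj x R) (?s u)"
    by (rule highest_ge[OF up])
  define m where "m = highest (swap_adj x R) (?s u)"
  have r: "(u, ?s m) \<in> R\<^sup>*"
    using highest_reachable[OF up, of "?s u"] by (simp add: m_def swap_adj_rtrancl_iff)
  have "?s m \<le> highest R u"
    by (rule highest_ge[OF assms(1) r])
  moreover have "Suc x < highest R u" if "(u, x) \<in> R\<^sup>*"
    using highest_mono[OF assms(1) that] assms(3) by simp
  moreover have "(u, highest R u) \<in> R\<^sup>*"
    by (rule highest_reachable[OF assms(1)])
  ultimately show "m \<le> ?s (highest R u)"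
    using r by (auto simp: Transposition.transpose_def split: if_splits)
qed

text \<open>This is \<open>hrv_partition\<close> with an arbitrary labelling in place of
  \<open>hrv P \<theta>\<close>, so that partitions can be compared between different
  graphs.\<close>

definition class_sizes :: "nat \<Rightarrow> (nat \<Rightarrow> nat) \<Rightarrow> nat multiset" where
  "class_sizes n k = {# card {u \<in> {1..n}. k u = v}. v \<in># mset_set (k ` {1..n}) #}"

text \<open>\<open>s\<close> carries the class labelled \<open>v\<close> onto the class labelled
  \<open>t v\<close>, and injectivity of \<open>t\<close> keeps distinct classes distinct.\<close>

lemma class_sizes_reindex:
  assumes s: "bij_betw s {1..n} {1..n}" and t: "inj t"
    and eq: "\<And>u. k' (s u) = t (k u)"
  shows "class_sizes n k' = class_sizes n k"
proof -
  have "k' ` {1..n} = k' ` s ` {1..n}"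
    by (simp only: bij_betw_imp_surj_on[OF s])
  also have "\<dots> = t ` k ` {1..n}"
    by (simp only: image_image eq)
  finally have im: "k' ` {1..n} = t ` k ` {1..n}" .
  have "card {u \<in> {1..n}. k' u = t v} = card {u \<in> {1..n}. k u = v}" for v
  proof -
    have "{u \<in> {1..n}. k' u = t v} = s ` {u \<in> {1..n}. k u = v}"
    proof (intro set_eqI iffI)
      fix u assume u: "u \<in> {u \<in> {1..n}. k' u = t v}"
      then obtain u' where "u' \<in> {1..n}" "u = s u'"
        using bij_betw_imp_surj_on[OF s] by blast
      with u show "u \<in> s ` {u \<in> {1..n}. k u = v}"
        using eq injD[OF t] by auto
    qed (use s eq in \<open>auto simp: bij_betw_def\<close>)
    moreover have "inj_on s {u \<in> {1..n}. k u = v}"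
      using s by (auto simp: bij_betw_def intro: inj_on_subset)
    ultimately show ?thesis by (simp add: card_image)
  qed
  moreover have "mset_set (t ` k ` {1..n}) = image_mset t (mset_set (k ` {1..n}))"
    using t by (intro image_mset_mset_set[symmetric]) (auto intro: inj_on_subset)
  ultimately show ?thesis
    unfolding class_sizes_def im by (simp add: image_mset.compositionality comp_def)
qed

lemma class_sizes_swap_adj:
  assumes "upward R" "(x, Suc x) \<notin> R" "highest R x > Suc x" "1 \<le> x" "Suc x \<le> n"
  shows "class_sizes n (highest (swap_adj x R)) = class_sizes n (highest R)"
proof (rule class_sizes_reindex)
  show "bij_betw (adj_transp x) {1..n} {1..n}"
    using assms(4,5) by (intro bij_betwI[where g = "adj_transp x"]) (auto simp: Transposition.transpose_def)
  show "inj (adj_transp x)"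
    by (rule injI) (metis transpose_involutory)
qed (rule highest_swap_adj[OF assms(1-3)])

lemma sum_Pow_insert:
  assumes "finite C" "p \<notin> C"
  shows "sum F (Pow (insert p C)) = (\<Sum>A\<in>Pow C. F A + F (insert p A))"
proof -
  have "inj_on (insert p) (Pow C)"
    using assms(2) by (auto simp: inj_on_def)
  then show ?thesis
    using assms unfolding Pow_insert
    by (subst sum.union_disjoint) (auto simp: sum.reindex sum.distrib)
qed

section \<open>Exchanging twin vertices\<close>

locale twin_vertices =
  fixes n y x z :: nat
  assumes yx: "y < x" and xz: "Suc x < z" and x_ge: "1 \<le> x" and x_le: "Suc x \<le> n"
begin

abbreviation \<sigma> :: "(nat \<times> nat) set \<Rightarrow> (nat \<times> nat) set" where
  "\<sigma> \<equiv> swap_adj x"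

abbreviation sizes :: "(nat \<times> nat) set \<Rightarrow> nat multiset" where
  "sizes R \<equiv> class_sizes n (highest R)"

text \<open>
  In the names \<open>sizes_Pij\<close>, the digit \<open>i\<close> tells whether the arc \<open>(x, Suc x)\<close> is added to the strict
  arcs of \<open>P\<close>, and \<open>j\<close> whether \<open>(Suc x, z)\<close> is.
\<close>

definition R_P :: "(nat \<times> nat) set \<Rightarrow> (nat \<times> nat) set" where
  "R_P R = insert (y, x) (insert (x, z) R)"

definition R_Q :: "(nat \<times> nat) set \<Rightarrow> (nat \<times> nat) set" where
  "R_Q R = insert (y, Suc x) (insert (Suc x, z) R)"

text \<open>If \<open>(x, Suc x) \<notin> R\<close>, these are the highest vertices reachable from \<open>x\<close> and \<open>Suc x\<close> after
  joining both to \<open>z\<close>.\<close>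

definition \<alpha> :: "(nat \<times> nat) set \<Rightarrow> nat" where
  "\<alpha> R = max (highest R x) (highest R z)"

definition \<beta> :: "(nat \<times> nat) set \<Rightarrow> nat" where
  "\<beta> R = max (highest R (Suc x)) (highest R z)"

section \<open>Matching the special arcs over a fixed set of common arcs\<close>

context
  fixes R :: "(nat \<times> nat) set"
  assumes up: "upward R" and nedge: "(x, Suc x) \<notin> R"
begin

lemma z_le: "z \<le> highest R z"
  by (rule highest_ge_self[OF up])

lemma up_swap: "upward (\<sigma> R)"
  by (rule upward_swap_adj[OF up nedge])

lemma nedge_swap: "(x, Suc x) \<notin> \<sigma> R"
  using up by (auto simp: swap_adj_iff upward_def)

text \<open>Once both twins are joined to \<open>z\<close>, their highest vertices exceed
  \<open>Suc x\<close>. The transposition fixes such values, so it merely exchanges the two.\<close>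

lemma \<alpha>\<beta>_swap: "\<alpha> (\<sigma> R) = \<beta> R" "\<beta> (\<sigma> R) = \<alpha> R"
proof -
  let ?R = "insert (x, z) (insert (Suc x, z) R)"
  have sw: "\<sigma> ?R = insert (x, z) (insert (Suc x, z) (\<sigma> R))"
    using xz by (simp add: swap_adj_insert Transposition.transpose_def insert_commute)
  have "highest ?R x > Suc x"
    using up nedge xz z_le by (simp add: highest_insert_simps)
  then have "highest (\<sigma> ?R) (adj_transp x u) = adj_transp x (highest ?R u)" for u
    using up nedge xz by (intro highest_swap_adj) auto
  from this[of x] this[of "Suc x"] show "\<alpha> (\<sigma> R) = \<beta> R" "\<beta> (\<sigma> R) = \<alpha> R"
    unfolding sw using up nedge up_swap nedge_swap xz z_le
    by (simp_all add: highest_insert_simps \<alpha>_def \<beta>_def Transposition.transpose_def split: if_splits)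
qed

text \<open>The two arc sets are mirror images, and the arc from \<open>x\<close> to
  \<open>z\<close> supplies the bound that \<open>class_sizes_swap_adj\<close> asks for.\<close>

lemma sizes_P00: "sizes (R_P R) = sizes (R_Q (\<sigma> R))"
proof -
  have "R_Q (\<sigma> R) = \<sigma> (R_P R)"
    using yx xz by (simp add: R_P_def R_Q_def swap_adj_insert Transposition.transpose_def)
  moreover have "sizes (\<sigma> (R_P R)) = sizes (R_P R)"
    using up nedge xz yx x_ge x_le z_le unfolding R_P_def
    by (intro class_sizes_swap_adj) (auto simp: highest_insert_simps)
  ultimately show ?thesis by simp
qed

text \<open>Both sides contain the path \<open>y\<close>, \<open>x\<close>, \<open>Suc x\<close>,
  \<open>z\<close>, so the arcs in which they differ, \<open>(x, z)\<close> and
  \<open>(y, Suc x)\<close>, are shortcuts.\<close>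

lemma sizes_P11:
  "sizes (insert (x, Suc x) (insert (Suc x, z) (R_P R))) =
    sizes (insert (x, Suc x) (insert (y, x) (R_Q R)))"
proof -
  let ?B = "insert (x, Suc x) (insert (Suc x, z) (insert (y, x) R))"
  have "upward ?B" using up xz yx by simp
  have "highest (insert (x, z) ?B) = highest ?B" "highest (insert (y, Suc x) ?B) = highest ?B"
    using up xz yx
    by (auto intro!: highest_insert_redundant highest_mono
        intro: rtrancl_into_rtrancl[OF r_into_rtrancl])
  then show ?thesis
    by (simp add: R_P_def R_Q_def insert_commute)
qed

text \<open>Both sides have the same highest vertices as their union. As
  \<open>\<alpha> R < \<beta> R\<close>, the vertex \<open>Suc x\<close> reaches higher than
  \<open>z\<close> even without its arc to \<open>z\<close>.\<close>

lemma sizes_P10_lt: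
  assumes "\<alpha> R < \<beta> R"
  shows "sizes (insert (x, Suc x) (R_P R)) = sizes (insert (x, Suc x) (R_Q R))"
proof -
  let ?A = "insert (x, Suc x) (R_P R)" and ?B = "insert (x, Suc x) (R_Q R)"
  have upA: "upward ?A" and upB: "upward ?B"
    using up xz yx by (simp_all add: R_P_def R_Q_def)
  have "highest (insert (y, Suc x) (insert (Suc x, z) ?A)) = highest (insert (Suc x, z) ?A)"
    using upA xz yx unfolding R_P_def
    by (auto intro!: highest_insert_redundant highest_mono
        intro: rtrancl_into_rtrancl[OF r_into_rtrancl])
  also have "\<dots> = highest ?A"
    using upA up xz yx assms
    by (intro highest_insert_redundant)
      (auto simp: R_P_def highest_insert_simps \<alpha>_def \<beta>_def)
  finally have A: "highest (insert (y, Suc x) (insert (Suc x, z) ?A)) = highest ?A" .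
  have "highest (insert (y, x) (insert (x, z) ?B)) = highest (insert (x, z) ?B)"
  proof (rule highest_insert_redundant)
    \<comment> \<open>Through \<open>Suc x\<close> the vertex \<open>x\<close> gains
      \<open>\<beta> R\<close>, which exceeds its own \<open>\<alpha> R\<close>.\<close>
    have "highest (insert (x, z) ?B) x = highest (insert (x, z) ?B) (Suc x)"
      using up nedge xz yx assms
      by (simp add: R_Q_def highest_insert_simps \<alpha>_def \<beta>_def)
    also have "\<dots> \<le> highest (insert (x, z) ?B) y"
      using upB xz by (intro highest_mono) (auto simp: R_Q_def)
    finally show "highest (insert (x, z) ?B) x \<le> highest (insert (x, z) ?B) y" .
  qed (use upB xz in simp)
  also have "\<dots> = highest ?B"
    using upB xz yx unfolding R_Q_def
    by (auto intro!: highest_insert_redundant highest_mono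
        intro: rtrancl_into_rtrancl[OF r_into_rtrancl])
  finally have "highest (insert (y, x) (insert (x, z) ?B)) = highest ?B" .
  with A show ?thesis
    by (simp add: R_P_def R_Q_def insert_commute)
qed

text \<open>Again both sides agree with their union: \<open>x\<close> reaches higher than
  \<open>z\<close> without an arc to \<open>z\<close>, and an arc from \<open>y\<close> to
  \<open>Suc x\<close> adds nothing beyond the one to \<open>x\<close>.\<close>

lemma sizes_P01_gt:
  assumes "\<beta> R < \<alpha> R"
  shows "sizes (insert (Suc x, z) (R_P R)) = sizes (insert (y, x) (R_Q R))"
proof -
  let ?A = "insert (Suc x, z) (R_P R)" and ?B = "insert (y, x) (R_Q R)"
  have upA: "upward ?A" and upB: "upward ?B"
    using up xz yx by (simp_all add: R_P_def R_Q_def)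
  have "highest (insert (y, Suc x) ?A) = highest ?A"
  proof (rule highest_insert_redundant[OF upA])
    have "?A = insert (y, x) (insert (x, z) (insert (Suc x, z) R))"
      by (simp add: R_P_def insert_commute)
    then have "highest ?A (Suc x) \<le> highest ?A x"
      using up nedge xz yx assms
      by (simp add: highest_insert_simps \<alpha>_def \<beta>_def)
    also have "\<dots> \<le> highest ?A y"
      using upA by (intro highest_mono) (auto simp: R_P_def)
    finally show "highest ?A (Suc x) \<le> highest ?A y" .
  qed
  moreover have "highest (insert (x, z) ?B) = highest ?B"
    using upB up nedge xz yx assms
    by (intro highest_insert_redundant)
      (auto simp: R_Q_def highest_insert_simps \<alpha>_def \<beta>_def)
  ultimately show ?thesis
    by (simp add: R_P_def R_Q_def insert_commute)
qed

lemma sizes_P01_le: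
  assumes "\<alpha> R \<le> \<beta> R"
  shows "sizes (insert (Suc x, z) (R_P R)) = sizes (insert (x, Suc x) (R_Q (\<sigma> R)))"
proof -
  let ?A = "insert (x, z) (R_Q (\<sigma> R))" and ?B = "insert (x, Suc x) (R_Q (\<sigma> R))"
  have upA: "upward ?A" and upB: "upward ?B"
    using up_swap xz yx by (simp_all add: R_Q_def)
  have sw: "\<sigma> (insert (Suc x, z) (R_P R)) = ?A"
    using yx xz by (simp add: R_P_def R_Q_def swap_adj_insert Transposition.transpose_def)
  have "insert (Suc x, z) (R_P R) = insert (y, x) (insert (x, z) (insert (Suc x, z) R))"
    by (simp add: R_P_def insert_commute)
  then have "highest (insert (Suc x, z) (R_P R)) x > Suc x"
    using up nedge xz yx z_le by (simp add: highest_insert_simps)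
  then have "sizes (insert (Suc x, z) (R_P R)) = sizes ?A"
    unfolding sw[symmetric] using up nedge xz yx x_ge x_le
    by (intro class_sizes_swap_adj[symmetric]) (auto simp: R_P_def)
  moreover have "highest (insert (x, Suc x) ?A) = highest ?A"
    using upA up_swap nedge_swap xz yx assms[folded \<alpha>\<beta>_swap]
    by (intro highest_insert_redundant)
      (auto simp: R_Q_def highest_insert_simps \<alpha>_def \<beta>_def)
  moreover have "highest (insert (x, z) ?B) = highest ?B"
    using upB xz yx unfolding R_Q_def
    by (auto intro!: highest_insert_redundant highest_mono
        intro: rtrancl_into_rtrancl[OF r_into_rtrancl])
  ultimately show ?thesis
    by (simp add: insert_commute)
qed

text \<open>Neither special arc has an effect: \<open>Suc x\<close> reaches no higher than
  \<open>x\<close>, and after the exchange \<open>x\<close> reaches no higher than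
  \<open>Suc x\<close>, to which \<open>y\<close> is already joined. What remains is
  \<open>sizes_P00\<close>.\<close>

lemma sizes_P10_ge:
  assumes "\<beta> R \<le> \<alpha> R"
  shows "sizes (insert (x, Suc x) (R_P R)) = sizes (insert (y, x) (R_Q (\<sigma> R)))"
proof -
  have "highest (insert (x, Suc x) (R_P R)) = highest (R_P R)"
    using up nedge xz yx assms
    by (intro highest_insert_redundant)
      (auto simp: R_P_def highest_insert_simps \<alpha>_def \<beta>_def)
  moreover have "highest (insert (y, x) (R_Q (\<sigma> R))) = highest (R_Q (\<sigma> R))"
  proof (rule highest_insert_redundant)
    show "upward (R_Q (\<sigma> R))"
      using up_swap xz yx by (simp add: R_Q_def)
    have "highest (R_Q (\<sigma> R)) x \<le> highest (R_Q (\<sigma> R)) (Suc x)"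
      using up_swap nedge_swap xz yx assms[folded \<alpha>\<beta>_swap]
      by (simp add: R_Q_def highest_insert_simps \<alpha>_def \<beta>_def)
    also have "\<dots> \<le> highest (R_Q (\<sigma> R)) y"
      using \<open>upward (R_Q (\<sigma> R))\<close> by (intro highest_mono) (auto simp: R_Q_def)
    finally show "highest (R_Q (\<sigma> R)) x \<le> highest (R_Q (\<sigma> R)) y" .
  qed
  ultimately show ?thesis
    by (simp add: sizes_P00)
qed

end

section \<open>Summation over all sets of ascending arcs\<close>

lemma sum_swap_adj:
  assumes "\<sigma> C = C"
  shows "(\<Sum>A\<in>Pow C. F (\<sigma> A)) = (\<Sum>A\<in>Pow C. F A)"
  by (rule sum.reindex_bij_witness[where i = \<sigma> and j = \<sigma>])
    (use swap_adj_Pow[OF assms] in auto)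

text \<open>\<open>G\<close> stands for the weight of an orientation. Matched choices have equally
  many special arcs, and the exchange preserves the number of common ones, so the case lemmas apply
  term by term.\<close>

lemma sum_twin_exchange:
  fixes G :: "nat \<Rightarrow> nat multiset \<Rightarrow> 'b :: comm_monoid_add"
  assumes C: "upward C" "\<sigma> C = C" "(x, Suc x) \<notin> C" "(Suc x, z) \<notin> C" "(y, x) \<notin> C"
    and T: "upward T" "\<sigma> T = T" "(x, Suc x) \<notin> T"
  shows "(\<Sum>A\<in>Pow (insert (x, Suc x) (insert (Suc x, z) C)). G (card A) (sizes (A \<union> R_P T))) =
    (\<Sum>A\<in>Pow (insert (x, Suc x) (insert (y, x) C)). G (card A) (sizes (A \<union> R_Q T)))"
proof -
  have finC: "finite C" using C(1) by (simp add: upward_def)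
  \<comment> \<open>\<open>B\<close> collects the chosen special arcs, \<open>A\<close> the chosen
    common ones, and \<open>T\<close> the common strict arcs.\<close>
  define P where "P B A = G (card (B \<union> A)) (sizes (B \<union> R_P (A \<union> T)))" for B A
  define Q where "Q B A = G (card (B \<union> A)) (sizes (B \<union> R_Q (A \<union> T)))" for B A
  define a where "a A = \<alpha> (A \<union> T)" for A
  define b where "b A = \<beta> (A \<union> T)" for A
  let ?e = "(x, Suc x)" and ?p = "(Suc x, z)" and ?q = "(y, x)"
  have A: "upward (A \<union> T)" "(x, Suc x) \<notin> A \<union> T" "\<sigma> (A \<union> T) = \<sigma> A \<union> T" "finite A" "?e \<notin> A" "?p \<notin> A" "?q \<notin> A"
    if "A \<in> Pow C" for A
    using that C T finC upward_subset[OF C(1)]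
    by (auto simp: swap_adj_Un intro: finite_subset)
  have \<sigma>A: "finite (\<sigma> A)" "?e \<notin> \<sigma> A" "?p \<notin> \<sigma> A" "?q \<notin> \<sigma> A" if "A \<in> Pow C" for A
    using A[OF swap_adj_Pow[OF C(2) that]] by auto
  have ab: "a (\<sigma> A) = b A" "b (\<sigma> A) = a A" if "A \<in> Pow C" for A
    using \<alpha>\<beta>_swap[OF A(1,2)[OF that]] A(3)[OF that] by (simp_all add: a_def b_def)
  have P00: "P {} A = Q {} (\<sigma> A)" if "A \<in> Pow C" for A
    using sizes_P00[OF A(1,2)[OF that]] A(3)[OF that] by (simp add: P_def Q_def)
  have P11: "P {?e, ?p} A = Q {?e, ?q} A" if "A \<in> Pow C" for A
    using sizes_P11[OF A(1,2)[OF that]] A[OF that] xz yx by (simp add: P_def Q_def)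
  have P01: "P {?p} A = (if a A \<le> b A then Q {?e} (\<sigma> A) else Q {?q} A)" if "A \<in> Pow C" for A
    using sizes_P01_le[OF A(1,2)[OF that]] sizes_P01_gt[OF A(1,2)[OF that]] A[OF that] \<sigma>A[OF that]
    by (simp add: P_def Q_def a_def b_def)
  have P10: "P {?e} A = (if b A \<le> a A then Q {?q} (\<sigma> A) else Q {?e} A)" if "A \<in> Pow C" for A
    using sizes_P10_ge[OF A(1,2)[OF that]] sizes_P10_lt[OF A(1,2)[OF that]] A[OF that] \<sigma>A[OF that]
    by (simp add: P_def Q_def a_def b_def)
  have split: "(\<Sum>A\<in>Pow C. if c A then f A else g A) =
      (\<Sum>A\<in>Pow C. if c A then f A else 0) + (\<Sum>A\<in>Pow C. if c A then 0 else g A)"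
    for c and f g :: "(nat \<times> nat) set \<Rightarrow> 'b"
    unfolding sum.distrib[symmetric] by (rule sum.cong) auto
  have "(\<Sum>A\<in>Pow C. P {?p} A + P {?e} A) =
      (\<Sum>A\<in>Pow C. (if a A \<le> b A then Q {?e} (\<sigma> A) else Q {?q} A)) +
      (\<Sum>A\<in>Pow C. (if b A \<le> a A then Q {?q} (\<sigma> A) else Q {?e} A))"
    by (simp add: P01 P10 sum.distrib)
  also have "\<dots> =
      (\<Sum>A\<in>Pow C. if a A \<le> b A then Q {?e} (\<sigma> A) else 0) +
      (\<Sum>A\<in>Pow C. if a A \<le> b A then 0 else Q {?q} A) +
      ((\<Sum>A\<in>Pow C. if b A \<le> a A then Q {?q} (\<sigma> A) else 0) +
      (\<Sum>A\<in>Pow C. if b A \<le> a A then 0 else Q {?e} A))"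
    by (rule arg_cong2[where f = "(+)"]; rule split)
  \<comment> \<open>Reindexing by \<open>\<sigma>\<close> exchanges \<open>a\<close> and
    \<open>b\<close>, which makes the condition complementary to that of the other sum over
    \<open>Q {?e}\<close>.\<close>
  also have "(\<Sum>A\<in>Pow C. if a A \<le> b A then Q {?e} (\<sigma> A) else 0) =
      (\<Sum>A\<in>Pow C. if b A \<le> a A then Q {?e} A else 0)"
    by (subst sum_swap_adj[OF C(2), symmetric], rule sum.cong) (auto simp: ab)
  also have "(\<Sum>A\<in>Pow C. if b A \<le> a A then Q {?q} (\<sigma> A) else 0) =
      (\<Sum>A\<in>Pow C. if a A \<le> b A then Q {?q} A else 0)"
    by (subst sum_swap_adj[OF C(2), symmetric], rule sum.cong) (auto simp: ab)
  also have "(\<Sum>A\<in>Pow C. if b A \<le> a A then Q {?e} A else 0) +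
      (\<Sum>A\<in>Pow C. if a A \<le> b A then 0 else Q {?q} A) +
      ((\<Sum>A\<in>Pow C. if a A \<le> b A then Q {?q} A else 0) +
      (\<Sum>A\<in>Pow C. if b A \<le> a A then 0 else Q {?e} A)) =
      (\<Sum>A\<in>Pow C. Q {?q} A + Q {?e} A)"
    unfolding sum.distrib[symmetric] by (rule sum.cong) (auto simp: ac_simps)
  finally have mixed: "(\<Sum>A\<in>Pow C. P {?p} A + P {?e} A) = (\<Sum>A\<in>Pow C. Q {?q} A + Q {?e} A)" .
  let ?FP = "\<lambda>A. G (card A) (sizes (A \<union> R_P T))"
  let ?FQ = "\<lambda>A. G (card A) (sizes (A \<union> R_Q T))"
  have "B \<union> A \<union> R_P T = B \<union> R_P (A \<union> T)" "B \<union> A \<union> R_Q T = B \<union> R_Q (A \<union> T)" for A B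
    by (auto simp: R_P_def R_Q_def)
  then have F: "?FP (B \<union> A) = P B A" "?FQ (B \<union> A) = Q B A" for A B
    by (simp_all add: P_def Q_def)
  have eqP: "sum ?FP (Pow (insert ?e (insert ?p C))) =
      (\<Sum>A\<in>Pow C. P {} A) + (\<Sum>A\<in>Pow C. P {?p} A + P {?e} A) + (\<Sum>A\<in>Pow C. P {?e, ?p} A)"
  proof -
    have "sum ?FP (Pow (insert ?e (insert ?p C))) =
        (\<Sum>A\<in>Pow (insert ?p C). ?FP A + ?FP (insert ?e A))"
      using C(3) finC by (intro sum_Pow_insert) auto
    also have "\<dots> = (\<Sum>A\<in>Pow C. (?FP A + ?FP (insert ?e A)) +
        (?FP (insert ?p A) + ?FP (insert ?e (insert ?p A))))"
      using C(4) finC by (intro sum_Pow_insert) auto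
    also have "\<dots> = (\<Sum>A\<in>Pow C. (P {} A + P {?e} A) + (P {?p} A + P {?e, ?p} A))"
      using F(1)[of "{}"] F(1)[of "{?e}"] F(1)[of "{?p}"] F(1)[of "{?e, ?p}"] by simp
    finally show ?thesis by (simp only: sum.distrib ac_simps)
  qed
  have eqQ: "sum ?FQ (Pow (insert ?e (insert ?q C))) =
      (\<Sum>A\<in>Pow C. Q {} A) + (\<Sum>A\<in>Pow C. Q {?q} A + Q {?e} A) + (\<Sum>A\<in>Pow C. Q {?e, ?q} A)"
  proof -
    have "sum ?FQ (Pow (insert ?e (insert ?q C))) =
        (\<Sum>A\<in>Pow (insert ?q C). ?FQ A + ?FQ (insert ?e A))"
      using C(3) finC yx by (intro sum_Pow_insert) auto
    also have "\<dots> = (\<Sum>A\<in>Pow C. (?FQ A + ?FQ (insert ?e A)) +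
        (?FQ (insert ?q A) + ?FQ (insert ?e (insert ?q A))))"
      using C(5) finC by (intro sum_Pow_insert) auto
    also have "\<dots> = (\<Sum>A\<in>Pow C. (Q {} A + Q {?e} A) + (Q {?q} A + Q {?e, ?q} A))"
      using F(2)[of "{}"] F(2)[of "{?e}"] F(2)[of "{?q}"] F(2)[of "{?e, ?q}"] by simp
    finally show ?thesis by (simp only: sum.distrib ac_simps)
  qed
  show ?thesis
    unfolding eqP eqQ mixed by (simp add: P00 P11 sum_swap_adj[OF C(2)])
qed

end

section \<open>Arcs of a lattice path\<close>

text \<open>With positions instead of indices into the word, a factorisation of a path becomes a
  union, and pieces shared by \<open>P\<close> and \<open>Q\<close> give equal sets.\<close>

fun located :: "nat \<times> nat \<Rightarrow> step list \<Rightarrow> ((nat \<times> nat) \<times> step) set" where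
  "located p [] = {}"
| "located p (s # w) = insert (p, s) (located (p + endpoint [s]) w)"

lemma endpoint_single [simp]:
  "endpoint [North] = (0, 1)" "endpoint [East] = (1, 0)" "endpoint [Diag] = (1, 1)"
  by (simp_all add: endpoint_def)

lemma endpoint_Nil [simp]: "endpoint [] = (0, 0)"
  by (simp add: endpoint_def)

lemma endpoint_append: "endpoint (v @ w) = endpoint v + endpoint w"
  by (simp add: endpoint_def)

lemma endpoint_Cons: "endpoint (s # w) = endpoint [s] + endpoint w"
  using endpoint_append[of "[s]" w] by simp

lemma located_append: "located p (v @ w) = located p v \<union> located (p + endpoint v) w"
proof (induction v arbitrary: p)
  case (Cons s v)
  then show ?case
    by (simp add: endpoint_Cons[of s v] add.assoc)
qed (simp add: prod_eq_iff plus_prod_def)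

lemma located_eq: "located p w = (\<lambda>i. (p + endpoint (take i w), w ! i)) ` {..<length w}"
proof (induction w arbitrary: p)
  case (Cons s w)
  have "{..<length (s # w)} = insert 0 (Suc ` {..<length w})"
    by (simp add: lessThan_Suc_eq_insert_0)
  then show ?case
    by (simp add: Cons image_image endpoint_Cons[of s "take _ w"] add.assoc
        prod_eq_iff plus_prod_def)
qed simp

lemma located_bounds:
  assumes "((c, h), s) \<in> located p w"
  shows "fst p \<le> c" "snd p \<le> h"
    "c + fst (endpoint [s]) \<le> fst (p + endpoint w)" "h + snd (endpoint [s]) \<le> snd (p + endpoint w)"
proof -
  have "fst p \<le> c \<and> snd p \<le> h \<and>
    c + fst (endpoint [s]) \<le> fst (p + endpoint w) \<and> h + snd (endpoint [s]) \<le> snd (p + endpoint w)"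
    using assms
  proof (induction w arbitrary: p)
    case (Cons t w)
    then consider "p = (c, h)" "s = t" | "((c, h), s) \<in> located (p + endpoint [t]) w"
      by auto
    then show ?case
    proof cases
      case 2
      from Cons.IH[OF this] show ?thesis by (auto simp: endpoint_Cons[of t w])
    qed (auto simp: endpoint_Cons[of t w])
  qed simp
  then show "fst p \<le> c" "snd p \<le> h"
    "c + fst (endpoint [s]) \<le> fst (p + endpoint w)" "h + snd (endpoint [s]) \<le> snd (p + endpoint w)"
    by auto
qed

lemma fst_endpoint_not_North: "s \<noteq> North \<Longrightarrow> fst (endpoint [s]) = 1"
  by (cases s) auto

text \<open>A step other than north increases the abscissa, which never decreases again.\<close>

lemma located_column_unique:
  assumes "((c, h), s) \<in> located p w" "((c, h'), s') \<in> located p w" "s \<noteq> North" "s' \<noteq> North"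
  shows "h = h' \<and> s = s'"
  using assms
proof (induction w arbitrary: p)
  case (Cons t w)
  have "fst p + 1 \<le> c" if "t \<noteq> North" "((c, h), s) \<in> located (p + endpoint [t]) w" for h s
    using located_bounds(1)[OF that(2)] fst_endpoint_not_North[OF that(1)] by simp
  then have "c \<noteq> fst p" if "t \<noteq> North" "((c, h), s) \<in> located (p + endpoint [t]) w" for h s
    using that by (metis Suc_eq_plus1 not_less_eq_eq order_refl)
  moreover have "t \<noteq> North \<and> c = fst p \<and> h = snd p \<and> s = t \<or> ((c, h), s) \<in> located (p + endpoint [t]) w"
    "t \<noteq> North \<and> c = fst p \<and> h' = snd p \<and> s' = t \<or> ((c, h'), s') \<in> located (p + endpoint [t]) w"
    using Cons.prems by auto
  ultimately show ?case
    using Cons.IH Cons.prems(3,4) by metis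
qed simp

text \<open>The step across column \<open>a\<close> bounds its squares. The bound is the starting
  height \<open>h\<close> even for a diagonal step, since that step cuts the next square in
  half.\<close>

definition nonstrict_arcs :: "step list \<Rightarrow> (nat \<times> nat) set" where
  "nonstrict_arcs P = {(a, b). 1 \<le> a \<and> a < b \<and> b \<le> path_size P \<and>
    (\<exists>h s. ((a - 1, h), s) \<in> located (0, 0) P \<and> s \<noteq> North \<and> b \<le> h)}"

definition strict_arcs :: "step list \<Rightarrow> (nat \<times> nat) set" where
  "strict_arcs P = {(a, b). 1 \<le> a \<and> a < b \<and> b \<le> path_size P \<and>
    ((a - 1, b - 1), Diag) \<in> located (0, 0) P}"

lemma located_origin:
  "((c, h), s) \<in> located (0, 0) P \<longleftrightarrow> (\<exists>i < length P. P ! i = s \<and> endpoint (take i P) = (c, h))"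
  by (auto simp: located_eq image_iff prod_eq_iff plus_prod_def)

lemma path_curve_iff:
  "(s, t) \<in> path_curve P \<longleftrightarrow>
    (\<exists>c h st u. ((c, h), st) \<in> located (0, 0) P \<and> 0 \<le> u \<and> u \<le> 1 \<and>
      s = real c + u * real (fst (endpoint [st])) \<and> t = real h + u * real (snd (endpoint [st])))"
proof -
  have seg: "(s, t) \<in> closed_segment (real_point p) (real_point (p + d)) \<longleftrightarrow>
      (\<exists>u. 0 \<le> u \<and> u \<le> 1 \<and> s = real (fst p) + u * real (fst d) \<and> t = real (snd p) + u * real (snd d))"
    for p d
    by (auto simp: closed_segment_def real_point_def algebra_simps)
  have "(s, t) \<in> path_curve P \<longleftrightarrow> (\<exists>i < length P.
      (s, t) \<in> closed_segment (real_point (endpoint (take i P)))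
        (real_point (endpoint (take i P) + endpoint [P ! i])))"
    by (auto simp: path_curve_def take_Suc_conv_app_nth endpoint_append)
  also have "\<dots> \<longleftrightarrow> (\<exists>c h st. ((c, h), st) \<in> located (0, 0) P \<and>
      (s, t) \<in> closed_segment (real_point (c, h)) (real_point ((c, h) + endpoint [st])))"
    unfolding located_origin by (metis prod.collapse)
  finally show ?thesis
    unfolding seg by simp
qed

text \<open>The vertical midline of a square already decides whether the square lies below the path.\<close>

lemma square_subset_region_iff:
  assumes "1 \<le> a" "a < b"
  shows "{real a - 1..real a} \<times> {real b - 1..real b} \<subseteq> path_region P \<longleftrightarrow>
    (\<exists>h s. ((a - 1, h), s) \<in> located (0, 0) P \<and> s \<noteq> North \<and> b \<le> h)"
proof
  assume "{real a - 1..real a} \<times> {real b - 1..real b} \<subseteq> path_region P"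
  then have "(real a - 1 / 2, real b) \<in> path_region P"
    by (rule subsetD) auto
  then obtain t where t: "real b \<le> t" "(real a - 1 / 2, t) \<in> path_curve P"
    by (auto simp: path_region_def)
  from t(2)[unfolded path_curve_iff] obtain c h s u where
    loc: "((c, h), s) \<in> located (0, 0) P" and u: "0 \<le> u" "u \<le> 1"
    and a: "real a - 1 / 2 = real c + u * real (fst (endpoint [s]))"
    and t': "t = real h + u * real (snd (endpoint [s]))"
    by blast
  \<comment> \<open>The abscissa \<open>a - 1/2\<close> is not an integer, so no vertical step
    contains the point.\<close>
  have "s \<noteq> North"
  proof
    assume "s = North"
    with a have "real (2 * a) = real (2 * c + 1)" by simp
    then have "2 * a = 2 * c + 1" by (simp only: of_nat_eq_iff)
    then show False by presburger
  qed
  with a have "real a - 1 / 2 = real c + u" by (simp add: fst_endpoint_not_North)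
  moreover from this u have "c = a - 1" using assms by linarith
  ultimately have "c = a - 1" "u = 1 / 2" using assms by (auto simp: of_nat_diff)
  \<comment> \<open>At the midline a diagonal step has risen by 1/2 only, and
    \<open>b \<le> h + 1/2\<close> forces \<open>b \<le> h\<close> for integers.\<close>
  have "b \<le> h"
    using t(1) t' \<open>u = 1 / 2\<close> by (cases s) auto
  then show "\<exists>h s. ((a - 1, h), s) \<in> located (0, 0) P \<and> s \<noteq> North \<and> b \<le> h"
    using loc \<open>s \<noteq> North\<close> \<open>c = a - 1\<close> by blast
next
  assume "\<exists>h s. ((a - 1, h), s) \<in> located (0, 0) P \<and> s \<noteq> North \<and> b \<le> h"
  then obtain h s where hs: "((a - 1, h), s) \<in> located (0, 0) P" "s \<noteq> North" "b \<le> h"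
    by blast
  show "{real a - 1..real a} \<times> {real b - 1..real b} \<subseteq> path_region P"
  proof clarify
    fix r t assume r: "r \<in> {real a - 1..real a}" and t: "t \<in> {real b - 1..real b}"
    define u where "u = r - real (a - 1)"
    define t' where "t' = real h + u * real (snd (endpoint [s]))"
    have u: "0 \<le> u" "u \<le> 1" "r = real (a - 1) + u * real (fst (endpoint [s]))"
      using r assms hs(2) by (auto simp: u_def fst_endpoint_not_North of_nat_diff)
    then have "(r, t') \<in> path_curve P"
      unfolding path_curve_iff t'_def using hs(1) by blast
    moreover have "t \<le> t'"
    proof -
      have "t \<le> real h" using t hs(3) by auto
      moreover have "0 \<le> u * real (snd (endpoint [s]))" using u(1) by simp
      ultimately show ?thesis by (simp add: t'_def)
    qed
    moreover have "r \<le> t" using r t assms(2) by auto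
    ultimately show "(r, t) \<in> path_region P"
      by (auto simp: path_region_def)
  qed
qed

lemma nonstrict_edges_iff:
  "{u, v} \<in> nonstrict_edges P \<longleftrightarrow> (u, v) \<in> nonstrict_arcs P \<or> (v, u) \<in> nonstrict_arcs P"
proof -
  have "nonstrict_edges P = {{a, b} | a b. (a, b) \<in> nonstrict_arcs P}"
    unfolding nonstrict_edges_def nonstrict_arcs_def
    by (rule Collect_cong) (simp add: square_subset_region_iff del: One_nat_def cong: conj_cong)
  then show ?thesis by (auto simp: doubleton_eq_iff)
qed

lemma strict_edges_iff:
  "{u, v} \<in> strict_edges P \<longleftrightarrow> (u, v) \<in> strict_arcs P \<or> (v, u) \<in> strict_arcs P"
proof -
  have "(\<exists>i < length P. P ! i = Diag \<and>
      endpoint (take i P) = (a - 1, b - 1) \<and> endpoint (take (Suc i) P) = (a, b)) \<longleftrightarrow>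
    ((a - 1, b - 1), Diag) \<in> located (0, 0) P" if "1 \<le> a" "a < b" for a b
    using that by (auto simp: located_origin take_Suc_conv_app_nth endpoint_append)
  then have "strict_edges P = {{a, b} | a b. (a, b) \<in> strict_arcs P}"
    unfolding strict_edges_def strict_arcs_def
    by (intro Collect_cong) (simp del: One_nat_def cong: conj_cong)
  then show ?thesis by (auto simp: doubleton_eq_iff)
qed

lemma nonstrict_arcs_less: "(u, v) \<in> nonstrict_arcs P \<Longrightarrow> u < v"
  by (simp add: nonstrict_arcs_def)

lemma strict_arcs_less: "(u, v) \<in> strict_arcs P \<Longrightarrow> u < v"
  by (simp add: strict_arcs_def)

text \<open>The only step across column \<open>u\<close> would have to start both at height
  \<open>v - 1\<close> and at a height at least \<open>v\<close>.\<close>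

lemma nonstrict_arcs_not_strict:
  "(u, v) \<in> nonstrict_arcs P \<Longrightarrow> (u, v) \<notin> strict_arcs P"
  by (fastforce simp: nonstrict_arcs_def strict_arcs_def dest: located_column_unique)

lemma upward_nonstrict_arcs: "upward (nonstrict_arcs P)"
  unfolding upward_def
  by (auto simp: nonstrict_arcs_def intro: finite_subset[of _ "{..path_size P} \<times> {..path_size P}"])

lemma upward_strict_arcs: "upward (strict_arcs P)"
  unfolding upward_def
  by (auto simp: strict_arcs_def intro: finite_subset[of _ "{..path_size P} \<times> {..path_size P}"])

text \<open>Strict arcs are forced and every non-strict arc outside \<open>A\<close> is reversed, so
  \<open>A\<close> can be chosen freely. Reversed arcs enter neither \<open>asc\<close> nor
  \<open>hrv\<close>.\<close>

lemma LLTe_sum_arcs: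
  "LLTe P t = (\<Sum>A\<in>Pow (nonstrict_arcs P). mps_const ((t - 1) ^ card A) *
    elem_sym_partition (class_sizes (path_size P) (highest (A \<union> strict_arcs P))))"
proof -
  let ?N = "nonstrict_arcs P" and ?S = "strict_arcs P"
  note arcs = nonstrict_arcs_less strict_arcs_less nonstrict_arcs_not_strict
  note edges = graph_edges_def nonstrict_edges_iff strict_edges_iff
  show ?thesis unfolding LLTe_def
  proof (rule sum.reindex_bij_witness[where i = "\<lambda>A. A \<union> ?S \<union> (?N - A)\<inverse>" and j = "\<lambda>\<theta>. \<theta> \<inter> ?N"])
    fix \<theta> assume \<theta>: "\<theta> \<in> orientations P"
    then have \<theta>1: "\<forall>(u, v)\<in>\<theta>. {u, v} \<in> graph_edges P"
      and \<theta>2: "\<forall>u v. {u, v} \<in> graph_edges P \<longrightarrow> ((u, v) \<in> \<theta>) \<noteq> ((v, u) \<in> \<theta>)"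
      and \<theta>3: "\<forall>u v. u < v \<and> {u, v} \<in> strict_edges P \<longrightarrow> (u, v) \<in> \<theta>"
      unfolding orientations_def by blast+
    have in_edge: "(u, v) \<in> ?N \<or> (v, u) \<in> ?N \<or> (u, v) \<in> ?S \<or> (v, u) \<in> ?S" if "(u, v) \<in> \<theta>" for u v
      using \<theta>1 that unfolding edges Un_iff by blast
    have one: "((u, v) \<in> \<theta>) \<noteq> ((v, u) \<in> \<theta>)" if "(u, v) \<in> ?N \<or> (u, v) \<in> ?S" for u v
      using \<theta>2 that unfolding edges Un_iff by blast
    have str: "(u, v) \<in> \<theta>" if "(u, v) \<in> ?S" for u v
      using \<theta>3 that strict_arcs_less[OF that] unfolding edges by blast
    show "\<theta> \<inter> ?N \<union> ?S \<union> (?N - \<theta> \<inter> ?N)\<inverse> = \<theta>"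
    proof (intro subset_antisym subrelI)
      fix u v
      show "(u, v) \<in> \<theta>" if "(u, v) \<in> \<theta> \<inter> ?N \<union> ?S \<union> (?N - \<theta> \<inter> ?N)\<inverse>"
        using that str one by blast
      show "(u, v) \<in> \<theta> \<inter> ?N \<union> ?S \<union> (?N - \<theta> \<inter> ?N)\<inverse>" if "(u, v) \<in> \<theta>"
        using that str one in_edge by blast
    qed
    show "\<theta> \<inter> ?N \<in> Pow ?N" by simp
    have asc: "ascending_edges P \<theta> = \<theta> \<inter> ?N"
      using nonstrict_arcs_less[of _ _ P] by (auto simp: ascending_edges_def edges dest: less_asym)
    have "{(a, b) \<in> \<theta>. {a, b} \<in> strict_edges P} = ?S"
      unfolding strict_edges_iff using str one by blast
    then have "hrv P \<theta> = highest (\<theta> \<inter> ?N \<union> ?S)"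
      by (simp add: fun_eq_iff hrv_def highest_def asc Un_commute)
    then show "mps_const ((t - 1) ^ card (\<theta> \<inter> ?N)) *
        elem_sym_partition (class_sizes (path_size P) (highest (\<theta> \<inter> ?N \<union> ?S))) =
      mps_const ((t - 1) ^ asc P \<theta>) * elem_sym_partition (hrv_partition P \<theta>)"
      by (simp add: asc_def asc hrv_partition_def class_sizes_def)
  next
    fix A assume "A \<in> Pow ?N"
    then have sub: "(u, v) \<in> A \<Longrightarrow> (u, v) \<in> ?N" for u v by auto
    have disj: "(v, u) \<notin> ?N" "(u, v) \<notin> ?S" "(v, u) \<notin> ?S" if "(u, v) \<in> ?N" for u v
      using arcs(1)[OF that] arcs(3)[OF that] arcs(1)[of v u P] arcs(2)[of v u P] by auto
    have disj_S: "(v, u) \<notin> ?S" if "(u, v) \<in> ?S" for u v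
      using arcs(2)[OF that] arcs(2)[of v u P] by auto
    show "(A \<union> ?S \<union> (?N - A)\<inverse>) \<inter> ?N = A"
      by (intro subset_antisym subrelI) (blast dest: sub disj)+
    have "(u, v) \<in> ?S" if "u < v" "(u, v) \<in> ?S \<or> (v, u) \<in> ?S" for u v
      using that arcs(2)[of v u P] by auto
    then show "A \<union> ?S \<union> (?N - A)\<inverse> \<in> orientations P"
      unfolding orientations_def edges Un_iff
      by (intro CollectI conjI allI impI) (blast dest: sub disj disj_S)+
  qed
qed

section \<open>The bounce decomposition\<close>

text \<open>Exchanging the two steps of a corner keeps its displacement. Hence \<open>U\<close>,
  \<open>V\<close> and \<open>W\<close> stay in place, and only the steps at the two corners
  differ.\<close>

lemma located_crossings:
  assumes UD: "endpoint (U @ [Diag]) = (y, x)"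
    and UV: "endpoint ((U @ [Diag]) @ North # V @ [Diag]) = (x, z)"
    and P: "P = U @ [Diag, North] @ V @ [Diag, East] @ W"
    and Q: "Q = U @ [North, Diag] @ V @ [East, Diag] @ W"
  shows "1 \<le> y" "1 \<le> x" "1 \<le> z"
    "located (0, 0) P = located (0, 0) U \<union> {((y - 1, x - 1), Diag), ((y, x), North)} \<union>
      located (y, x + 1) V \<union> {((x - 1, z - 1), Diag), ((x, z), East)} \<union> located (x + 1, z) W"
    "located (0, 0) Q = located (0, 0) U \<union> {((y - 1, x - 1), North), ((y - 1, x), Diag)} \<union>
      located (y, x + 1) V \<union> {((x - 1, z - 1), East), ((x, z - 1), Diag)} \<union> located (x + 1, z) W"
    "endpoint P = endpoint Q"
    "endpoint U = (y - 1, x - 1)" "(y, x + 1) + endpoint V = (x - 1, z - 1)"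
    "endpoint P = (x + 1, z) + endpoint W"
proof -
  obtain u1 u2 where U: "endpoint U = (u1, u2)" by force
  obtain v1 v2 where V: "endpoint V = (v1, v2)" by force
  have yx: "y = Suc u1" "x = Suc u2" "x = y + v1 + 1" "z = x + v2 + 2"
    using UD UV U V
    by (auto simp: endpoint_append endpoint_Cons[of _ "_ # _"] endpoint_Cons[of _ "_ @ _"])
  show "1 \<le> y" "1 \<le> x" "1 \<le> z" using yx by auto
  show "endpoint U = (y - 1, x - 1)" using U yx by simp
  show "(y, x + 1) + endpoint V = (x - 1, z - 1)" using V yx by simp
  note app = endpoint_append located_append endpoint_Cons[of _ "_ # _"] endpoint_Cons[of _ "_ @ _"]
    endpoint_Cons[of _ W]
  show "endpoint P = endpoint Q"
    unfolding P Q by (simp add: app prod_eq_iff)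
  show "endpoint P = (x + 1, z) + endpoint W"
    using U V yx unfolding P by (simp add: app prod_eq_iff)
  show "located (0, 0) P = located (0, 0) U \<union> {((y - 1, x - 1), Diag), ((y, x), North)} \<union>
      located (y, x + 1) V \<union> {((x - 1, z - 1), Diag), ((x, z), East)} \<union> located (x + 1, z) W"
    using U V yx unfolding P by (auto simp: app)
  show "located (0, 0) Q = located (0, 0) U \<union> {((y - 1, x - 1), North), ((y - 1, x), Diag)} \<union>
      located (y, x + 1) V \<union> {((x - 1, z - 1), East), ((x, z - 1), Diag)} \<union> located (x + 1, z) W"
    using U V yx unfolding Q by (auto simp: app)
qed

text \<open>The first bounce point is \<open>(x, x)\<close>, and the last has the ordinate of the
  stopping point as its coordinates. A single bounce point makes them equal.\<close>

lemma bounce_decomposition_single: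
  assumes "card (bounce_points P (x, z)) = 1" "bounce_decomposition P (x, z) U s1 s2 V s3 s4 W"
  shows "snd (endpoint (U @ [s1])) = x"
proof -
  let ?k = "bounce_length P (x, z)"
  \<comment> \<open>A bounce length of 0 would leave no bounce points.\<close>
  have k: "1 \<le> ?k"
    using assms(1) by (cases ?k) (auto simp: bounce_points_def)
  then have "(x, x) \<in> bounce_points P (x, z)"
    by (auto simp: bounce_points_def intro!: exI[of _ "Suc 0"])
  moreover have "(bounce_seq P (x, z) ?k, bounce_seq P (x, z) ?k) \<in> bounce_points P (x, z)"
    using k by (auto simp: bounce_points_def)
  moreover obtain p where "bounce_points P (x, z) = {p}"
    using assms(1) by (rule card_1_singletonE)
  ultimately show ?thesis
    using assms(2) by (auto simp: bounce_decomposition_def)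
qed

theorem theorem5p17:
  fixes n x z :: nat and P Q U V W :: "step list" and q :: "int poly"
  assumes "schroeder_path n P"
    and "(x, z) \<in> lattice_points P"
    and "z > x + 1"
    and "card (bounce_points P (x, z)) = 1"
    and "bounce_decomposition P (x, z) U Diag North V Diag East W"
    and "Q = U @ [North, Diag] @ V @ [East, Diag] @ W"
    and "q = [:0, 1:]"
  shows "LLTe P (q + 1) = LLTe Q (q + 1)"
proof -
  define y where "y = fst (endpoint (U @ [Diag]))"
  have UD: "endpoint (U @ [Diag]) = (y, x)"
    using bounce_decomposition_single[OF assms(4,5)] by (simp add: y_def prod_eq_iff)
  have P: "P = U @ [Diag, North] @ V @ [Diag, East] @ W"
    and UV: "endpoint ((U @ [Diag]) @ North # V @ [Diag]) = (x, z)"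
    using assms(5) by (simp_all add: bounce_decomposition_def)
  note loc = located_crossings[OF UD UV P assms(6)]
  have size: "path_size P = n" "path_size Q = n"
    using assms(1) loc(6) by (simp_all add: path_size_def schroeder_path_def)
  \<comment> \<open>This is the Schroeder condition at the diagonal step following
    \<open>U\<close>.\<close>
  have "count_list U East < count_list U North"
    using assms(1) unfolding schroeder_path_def P by (auto dest: spec[of _ "length U"])
  then have "y < x"
    using loc(1,2,7) by (auto simp: endpoint_def)
  have W_end: "(x + 1, z) + endpoint W = (n, n)"
    using loc(9) assms(1) by (simp add: schroeder_path_def)
  then have n: "x + 1 \<le> n" "z \<le> n" by (auto simp: prod_eq_iff)
  interpret twin_vertices n y x z
    using \<open>y < x\<close> assms(3) loc(2) n by unfold_locales auto
  \<comment> \<open>\<open>K\<close> holds the located steps common to both paths; \<open>C\<close>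
    and \<open>T\<close> are the common non-strict and strict arcs. The last clauses of
    \<open>C\<close> are what the corner columns \<open>y\<close>, \<open>x\<close>,
    \<open>x + 1\<close> share in both paths, without \<open>(x, Suc x)\<close>.\<close>
  define K where "K = located (0, 0) U \<union> located (y, x + 1) V \<union> located (x + 1, z) W"
  define L where "L a b \<longleftrightarrow> (\<exists>h s. ((a - 1, h), s) \<in> K \<and> s \<noteq> North \<and> b \<le> h)" for a b
  define C where "C = {(a, b). 1 \<le> a \<and> a < b \<and> b \<le> n \<and>
    (L a b \<or>
      a = y \<and> b < x \<or> (a = x \<or> a = x + 1) \<and> x + 1 < b \<and> b < z)}"
  define T where "T = {(a, b). 1 \<le> a \<and> a < b \<and> b \<le> n \<and> ((a - 1, b - 1), Diag) \<in> K}"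
  \<comment> \<open>The three cases are the pieces \<open>U\<close>, \<open>V\<close> and
    \<open>W\<close>: left of column \<open>y\<close> and below height \<open>x\<close>, strictly
    between the corner columns and above height \<open>x\<close>, and right of column
    \<open>x + 1\<close>.\<close>
  have K_iff: "a < y \<and> h + snd (endpoint [s]) < x \<or> y < a \<and> a < x \<and> x < h \<or> x + 1 < a"
    if "((a - 1, h), s) \<in> K" "s \<noteq> North" "1 \<le> a" for a h s
  proof -
    have K: "((a - 1, h), s) \<in> K" by (rule that(1))
    have s: "fst (endpoint [s]) = 1" using that(2) by (rule fst_endpoint_not_North)
    consider "((a - 1, h), s) \<in> located (0, 0) U" | "((a - 1, h), s) \<in> located (y, x + 1) V"
      | "((a - 1, h), s) \<in> located (x + 1, z) W"
      using K unfolding K_def by blast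
    then show ?thesis
    proof cases
      case 1
      from located_bounds(3,4)[OF this] show ?thesis using s loc(1,2,7) that(3) by simp linarith
    next
      case 2
      from located_bounds(1-3)[OF this] show ?thesis unfolding loc(8) using s that(3) by simp linarith
    next
      case 3
      from located_bounds(1)[OF this] show ?thesis using that(3) by simp linarith
    qed
  qed
  have locP: "located (0, 0) P = K \<union>
      {((y - 1, x - 1), Diag), ((y, x), North), ((x - 1, z - 1), Diag), ((x, z), East)}"
    unfolding loc(4) K_def by auto
  have locQ: "located (0, 0) Q = K \<union>
      {((y - 1, x - 1), North), ((y - 1, x), Diag), ((x - 1, z - 1), East), ((x, z - 1), Diag)}"
    unfolding loc(5) K_def by auto
  have L_source: "a \<noteq> x \<and> a \<noteq> Suc x \<and> a \<noteq> y" if "L a b" "1 \<le> a" for a b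
    using that(1) K_iff[OF _ _ that(2)] \<open>y < x\<close> unfolding L_def by auto
  \<comment> \<open>Column \<open>a\<close> begins at abscissa \<open>a - 1\<close>. The columns
    \<open>y\<close>, \<open>x\<close>, \<open>x + 1\<close> are crossed from heights
    \<open>x - 1\<close>, \<open>z - 1\<close>, \<open>z\<close> in \<open>P\<close> and from
    \<open>x\<close>, \<open>z - 1\<close>, \<open>z - 1\<close> in \<open>Q\<close>.\<close>
  have colP: "(\<exists>h s. ((a - 1, h), s) \<in> located (0, 0) P \<and> s \<noteq> North \<and> b \<le> h) \<longleftrightarrow>
      L a b \<or> a = y \<and> b < x \<or> a = x \<and> b < z \<or> a = x + 1 \<and> b \<le> z" if "1 \<le> a" for a b
    using that loc(1-3) unfolding locP Un_iff insert_iff L_def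
    by (simp add: conj_disj_distribR ex_disj_distrib eq_diff_iff) auto
  have colQ: "(\<exists>h s. ((a - 1, h), s) \<in> located (0, 0) Q \<and> s \<noteq> North \<and> b \<le> h) \<longleftrightarrow>
      L a b \<or> a = y \<and> b \<le> x \<or> a = x \<and> b < z \<or> a = x + 1 \<and> b < z" if "1 \<le> a" for a b
    using that loc(1-3) unfolding locQ Un_iff insert_iff L_def
    by (simp add: conj_disj_distribR ex_disj_distrib eq_diff_iff) auto
  have arcsP: "nonstrict_arcs P = {(a, b). 1 \<le> a \<and> a < b \<and> b \<le> n \<and>
      (L a b \<or> a = y \<and> b < x \<or> a = x \<and> b < z \<or> a = x + 1 \<and> b \<le> z)}"
    unfolding nonstrict_arcs_def size by (simp add: colP del: One_nat_def cong: conj_cong)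
  have "(a, b) \<in> nonstrict_arcs P \<longleftrightarrow> (a, b) \<in> insert (x, Suc x) (insert (Suc x, z) C)" for a b
  proof -
    note facts = loc(1,2) n \<open>y < x\<close> assms(3) L_source[of a b]
    consider "a = x" | "a = Suc x" | "a = y" | "a \<noteq> x" "a \<noteq> Suc x" "a \<noteq> y" by blast
    then show ?thesis
    proof cases
      case 1
      show ?thesis unfolding arcsP C_def 1 using facts[unfolded 1] by auto
    next
      case 2
      show ?thesis unfolding arcsP C_def 2 using facts[unfolded 2] by auto
    next
      case 3
      show ?thesis unfolding arcsP C_def 3 using facts[unfolded 3] by auto
    next
      case 4
      then show ?thesis unfolding arcsP C_def by simp
    qed
  qed
  then have NP: "nonstrict_arcs P = insert (x, Suc x) (insert (Suc x, z) C)"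
    by (simp only: set_eq_iff split_paired_All) simp
  have arcsQ: "nonstrict_arcs Q = {(a, b). 1 \<le> a \<and> a < b \<and> b \<le> n \<and>
      (L a b \<or> a = y \<and> b \<le> x \<or> a = x \<and> b < z \<or> a = x + 1 \<and> b < z)}"
    unfolding nonstrict_arcs_def size by (simp add: colQ del: One_nat_def cong: conj_cong)
  have "(a, b) \<in> nonstrict_arcs Q \<longleftrightarrow> (a, b) \<in> insert (x, Suc x) (insert (y, x) C)" for a b
  proof -
    note facts = loc(1,2) n \<open>y < x\<close> assms(3) L_source[of a b]
    consider "a = x" | "a = Suc x" | "a = y" | "a \<noteq> x" "a \<noteq> Suc x" "a \<noteq> y" by blast
    then show ?thesis
    proof cases
      case 1
      show ?thesis unfolding arcsQ C_def 1 using facts[unfolded 1] by auto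
    next
      case 2
      show ?thesis unfolding arcsQ C_def 2 using facts[unfolded 2] by auto
    next
      case 3
      show ?thesis unfolding arcsQ C_def 3 using facts[unfolded 3] by auto
    next
      case 4
      then show ?thesis unfolding arcsQ C_def by simp
    qed
  qed
  then have NQ: "nonstrict_arcs Q = insert (x, Suc x) (insert (y, x) C)"
    by (simp only: set_eq_iff split_paired_All) simp
  have rng: "y < x" "x < z" "y < Suc x" "Suc x < z" "1 \<le> y" "1 \<le> x" "1 \<le> Suc x"
    "x \<le> n" "Suc x \<le> n" "z \<le> n"
    using loc(1,2) n \<open>y < x\<close> assms(3) by simp_all
  have pred_eq: "a - 1 = b \<longleftrightarrow> a = Suc b" if "1 \<le> a" for a b :: nat
    using that by auto
  have "((a - 1, b - 1), Diag) \<in> located (0, 0) P \<longleftrightarrow>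
      (a, b) = (y, x) \<or> (a, b) = (x, z) \<or> ((a - 1, b - 1), Diag) \<in> K"
    if "1 \<le> a" "a < b" for a b
    using that loc(1-3) unfolding locP by (simp add: eq_diff_iff pred_eq del: One_nat_def)
  then have SP: "strict_arcs P = R_P T"
    using rng unfolding strict_arcs_def T_def R_P_def size by blast
  have "((a - 1, b - 1), Diag) \<in> located (0, 0) Q \<longleftrightarrow>
      (a, b) = (y, Suc x) \<or> (a, b) = (Suc x, z) \<or> ((a - 1, b - 1), Diag) \<in> K"
    if "1 \<le> a" "a < b" for a b
    using that loc(1-3) unfolding locQ by (simp add: eq_diff_iff pred_eq del: One_nat_def)
  then have SQ: "strict_arcs Q = R_Q T"
    using rng unfolding strict_arcs_def T_def R_Q_def size by blast
  have "upward C" "upward T"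
    using upward_nonstrict_arcs[of P] upward_strict_arcs[of P] by (simp_all add: NP SP R_P_def)
  moreover have "\<sigma> C = C"
  proof -
    \<comment> \<open>No step of \<open>K\<close> crosses a column left of \<open>x\<close> from
      height exactly \<open>x\<close>, so rows \<open>x\<close> and \<open>x + 1\<close> are either
      both below the step or both not.\<close>
    have K_row: "L a (Suc x) \<longleftrightarrow> L a x" if "1 \<le> a" "a < x" for a
    proof
      assume "L a x"
      then obtain h s where h: "((a - 1, h), s) \<in> K" "s \<noteq> North" "x \<le> h"
        by (auto simp: L_def)
      with K_iff[OF h(1,2) that(1)] that(2) have "Suc x \<le> h" by auto
      with h show "L a (Suc x)" unfolding L_def by blast
    qed (use Suc_leD L_def in blast)
    have "(adj_transp x a, adj_transp x b) \<in> C" if "(a, b) \<in> C" for a b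
    proof (cases "a = x \<or> a = Suc x")
      case True
      with that x_ge show ?thesis
        unfolding C_def by (auto dest: L_source simp: Transposition.transpose_def)
    next
      case False
      with that x_le show ?thesis
        unfolding C_def by (auto simp: K_row simp: Transposition.transpose_def)
    qed
    then show ?thesis
      by (auto simp: swap_adj_iff) (metis transpose_involutory)
  qed
  moreover have "\<sigma> T = T"
  proof -
    \<comment> \<open>By \<open>K_iff\<close>, neither end of a common strict arc is
      \<open>x\<close> or \<open>Suc x\<close>.\<close>
    have "adj_transp x a = a \<and> adj_transp x b = b" if "(a, b) \<in> T" for a b
      using that K_iff[of a "b - 1" Diag] unfolding T_def by (auto simp: Transposition.transpose_def)
    then show ?thesis
      by (auto simp: swap_adj_iff) (metis transpose_involutory)
  qed
  moreover have "(x, Suc x) \<notin> C" "(Suc x, z) \<notin> C" "(y, x) \<notin> C" "(x, Suc x) \<notin> T"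
    using \<open>y < x\<close> K_iff[of x x Diag] unfolding C_def T_def by (auto dest: L_source)
  ultimately show ?thesis
    unfolding LLTe_sum_arcs size NP NQ SP SQ
    by (intro sum_twin_exchange[where G = "\<lambda>k \<mu>. mps_const ((q + 1 - 1) ^ k) * elem_sym_partition \<mu>"])
qed

end
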